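(* Fix $\epsilon>0$, $\delta\in(0,\tfrac1e)$ and $B>0$. Fix a positive integer $r$ and let $w$ be such that \[ w^2=B^2\left(1+\frac{1+\frac{\epsilon}{\ln(4/\delta)}}{\epsilon}\left(2\sqrt{2r\ln(\tfrac4\delta)}+2\ln(\tfrac4\delta)\right)\right). \] Let $A$ be an $(n\times d)$-matrix with $d<r$ in which every row has $\ell_2$-norm at most $B$. Given that $\sigma_{\min}(A)\ge w$, the algorithm that picks an $(r\times n)$-matrix $R$ whose entries are i.i.d. samples from $\mathcal N(0,1)$ and publishes $R\cdot A$ is $(\epsilon,\delta)$-differentially private.
   Context: $\sigma_{\min}(A)$ is the least singular value of $A$. Two $(n\times d)$-matrices are neighbors if they differ in exactly one row. A randomized algorithm defined on a class of inputs (here: $(n\times d)$-matrices with rows of $\ell_2$-norm at most $B$ and $\sigma_{\min}(A)\ge w$) is $(\epsilon,\delta)$-differentially private if for all neighboring inputs $A,A'$ in the class and every measurable set $S$ of outputs, $\Pr[\mathsf{ALG}(A)\in S]\le e^{\epsilon}\Pr[\mathsf{ALG}(A')\in S]+\delta$. *)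

theory Defs
  imports "HOL-Probability.Probability"
begin

text \<open>Least singular value of an (n x d)-matrix A: the square root of the least
  eigenvalue of the (d x d) Gram matrix A^T A (the d singular values of A are
  the square roots of the eigenvalues of A^T A).\<close>
definition sigma_min :: "real ^ 'd ^ 'n \<Rightarrow> real" where
  "sigma_min A = sqrt (Inf {l. \<exists>v :: real ^ 'd. v \<noteq> 0 \<and>
                               (transpose A ** A) *v v = l *s v})"

definition neighbors :: "real ^ 'd ^ 'n \<Rightarrow> real ^ 'd ^ 'n \<Rightarrow> bool" where
  "neighbors A A' \<longleftrightarrow> card {i. A $ i \<noteq> A' $ i} = 1"

definition diff_private ::
  "('a \<Rightarrow> 'b measure) \<Rightarrow> ('a \<Rightarrow> bool) \<Rightarrow> ('a \<Rightarrow> 'a \<Rightarrow> bool) \<Rightarrow> real \<Rightarrow> real \<Rightarrow> bool" where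
  "diff_private ALG C nb \<epsilon> \<delta> \<longleftrightarrow>
     (\<forall>x x'. C x \<and> C x' \<and> nb x x' \<longrightarrow>
        (\<forall>S \<in> sets (ALG x). measure (ALG x) S \<le> exp \<epsilon> * measure (ALG x') S + \<delta>))"

definition gaussian_matrix :: "(real ^ 'n ^ 'r) measure" where
  "gaussian_matrix = distr (PiM (UNIV :: ('r \<times> 'n) set) (\<lambda>_. density lborel std_normal_density))
                           borel (\<lambda>f. \<chi> i j. f (i, j))"

definition gaussian_projection :: "real ^ 'd ^ 'n \<Rightarrow> (real ^ 'd ^ 'r) measure" where
  "gaussian_projection A = distr (gaussian_matrix :: (real ^ 'n ^ 'r) measure) borel (\<lambda>R. R ** A)"

end

theory Submission
  imports Defs
begin

text \<open>
  Let \<open>A0\<close> be \<open>A\<close> with the differing row \<open>a\<close> (index \<open>i\<close>) replaced by zero; privacy is obtained by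
  comparing \<open>RA\<close> with \<open>R A0\<close> and \<open>R A0\<close> with \<open>RA'\<close>. Since the least singular value of \<open>A\<close> exceeds
  \<open>B\<close>, there is a vector \<open>b\<close> orthogonal to the \<open>i\<close>-th axis with \<open>A0\<^sup>T b = a\<close> and
  \<open>|b|\<^sup>2 \<le> B\<^sup>2 / (w\<^sup>2 - B\<^sup>2)\<close>. By rotation invariance of the Gaussian, \<open>RA\<close> is then distributed as
  the image of \<open>R\<close>, with one column scaled by \<open>sqrt (1 + |b|\<^sup>2)\<close>, under the same linear map that
  sends \<open>R\<close> to \<open>R A0\<close> in law. It remains to compare \<open>N(0, 1)\<close> and \<open>N(0, 1 + |b|\<^sup>2)\<close> in \<open>r\<close>
  dimensions: pointwise, one density is at most \<open>exp \<epsilon>\<close> times the other plus \<open>exp (- t)\<close> times a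
  third Gaussian density, which is the Chernoff bound for the chi-squared distribution. The
  additive error of the second comparison is chosen smaller by the factor \<open>exp (- \<epsilon>)\<close> to survive
  the composition.
\<close>

subsection \<open>Gaussian vectors\<close>

text \<open>Tonelli over the coordinates: the product formula over \<open>Basis\<close>, reindexed
  along the bijection from \<open>i\<close> to \<open>axis i 1\<close>.\<close>

lemma nn_integral_lborel_vec_prod:
  fixes f :: "'i::finite \<Rightarrow> real \<Rightarrow> ennreal"
  assumes [measurable]: "\<And>i. f i \<in> borel_measurable borel"
  shows "(\<integral>\<^sup>+x. (\<Prod>i\<in>UNIV. f i (x $ i)) \<partial>(lborel :: (real ^ 'i) measure)) = (\<Prod>i\<in>UNIV. \<integral>\<^sup>+x. f i x \<partial>lborel)"
proof -
  have B: "(Basis :: (real ^ 'i) set) = (\<lambda>i. axis i 1) ` UNIV"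
    by (auto simp: Basis_vec_def)
  have inj: "inj (\<lambda>i::'i. axis i (1::real))"
    by (auto simp: inj_def axis_eq_axis)
  define g where "g b = f (inv (\<lambda>i. axis i (1::real)) b)" for b :: "real ^ 'i"
  have g: "g (axis i 1) = f i" for i
    unfolding g_def by (simp add: inv_f_f[OF inj])
  have "(\<integral>\<^sup>+x. (\<Prod>b\<in>Basis. g b (x \<bullet> b)) \<partial>(lborel :: (real ^ 'i) measure)) = (\<Prod>b\<in>Basis. \<integral>\<^sup>+x. g b x \<partial>lborel)"
    by (rule nn_integral_lborel_prod) (auto simp: g_def)
  then show ?thesis
    unfolding B by (simp add: prod.reindex[OF inj] g inner_axis)
qed

text \<open>Boxes determine a product measure: \<open>P\<close> is pushed to the function space,
  recognised there by \<open>PiM_eqI\<close>, and pushed back.\<close>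

lemma measure_vec_eqI_prod:
  fixes P :: "(real ^ 'i::finite) measure"
  assumes N: "\<And>i. sigma_finite_measure (N i)" "\<And>i. sets (N i) = sets borel"
    and P: "sets P = sets borel"
    and eq: "\<And>X. (\<And>i. X i \<in> sets borel) \<Longrightarrow> emeasure P {x. \<forall>i. x $ i \<in> X i} = (\<Prod>i\<in>UNIV. emeasure (N i) (X i))"
  shows "P = distr (PiM UNIV N) borel (\<lambda>f. \<chi> i. f i)"
proof -
  interpret product_sigma_finite N by (simp add: product_sigma_finite_def N(1))
  have sp: "space P = UNIV" using sets_eq_imp_space_eq[OF P] by simp
  have spN: "space (N i) = UNIV" for i using sets_eq_imp_space_eq[OF N(2), of i] by simp
  have comp: "(\<lambda>x i. x $ i) \<in> P \<rightarrow>\<^sub>M PiM UNIV N"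
    by (rule measurable_PiM_single')
       (auto simp: spN measurable_cong_sets[OF P N(2)] intro!: borel_measurable_nth)
  have [measurable]: "(\<lambda>f. f i) \<in> borel_measurable (PiM UNIV N)" for i
    using measurable_component_singleton[of i UNIV N] by (simp add: measurable_cong_sets[OF refl N(2)])
  have inv: "(\<lambda>f. \<chi> i. f i) \<in> PiM UNIV N \<rightarrow>\<^sub>M (borel :: (real^'i) measure)"
    by (subst borel_measurable_euclidean_space) (auto simp: Basis_vec_def inner_axis)
  have "distr P (PiM UNIV N) (\<lambda>x i. x $ i) = PiM UNIV N"
  proof (rule PiM_eqI)
    fix X assume X: "\<And>i. i \<in> UNIV \<Longrightarrow> X i \<in> sets (N i)"
    have "(\<lambda>x i. x $ i) -` (Pi\<^sub>E UNIV X) \<inter> space P = {x. \<forall>i. x $ i \<in> X i}"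
      by (auto simp: sp)
    then show "emeasure (distr P (Pi\<^sub>M UNIV N) (\<lambda>x i. x $ i)) (Pi\<^sub>E UNIV X) = (\<Prod>i\<in>UNIV. emeasure (N i) (X i))"
      using X N(2) by (subst emeasure_distr[OF comp]) (auto intro!: eq sets_PiM_I_finite)
  qed auto
  then have "distr (PiM UNIV N) borel (\<lambda>f. \<chi> i. f i) = distr (distr P (PiM UNIV N) (\<lambda>x i. x $ i)) borel (\<lambda>f. \<chi> i. f i)"
    by simp
  also have "\<dots> = distr P borel (\<lambda>x. x)"
    by (subst distr_distr[OF inv comp]) (simp add: comp_def)
  also have "\<dots> = P"
    using P by (simp add: distr_id2)
  finally show ?thesis ..
qed

text \<open>Independent centred Gaussians with standard deviations \<open>\<sigma> i\<close>, given
  by their joint Lebesgue density, since both rotation invariance and the later domination argue on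
  densities.\<close>

definition normal_vec :: "('i::finite \<Rightarrow> real) \<Rightarrow> (real ^ 'i) measure" where
  "normal_vec \<sigma> = density lborel (\<lambda>x. \<Prod>i\<in>UNIV. ennreal (normal_density 0 (\<sigma> i) (x $ i)))"

lemma sets_normal_vec [measurable_cong, simp]: "sets (normal_vec \<sigma>) = sets borel"
  by (simp add: normal_vec_def)

lemma space_normal_vec [simp]: "space (normal_vec \<sigma>) = UNIV"
  by (simp add: normal_vec_def)

lemma emeasure_normal_vec_box:
  fixes \<sigma> :: "'i::finite \<Rightarrow> real"
  assumes [measurable]: "\<And>i. X i \<in> sets borel"
  shows "emeasure (normal_vec \<sigma>) {x. \<forall>i. x $ i \<in> X i} =
    (\<Prod>i\<in>UNIV. emeasure (density lborel (normal_density 0 (\<sigma> i))) (X i))"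
proof -
  have ind: "indicator {x::real^'i. \<forall>i. x $ i \<in> X i} x = (\<Prod>i\<in>UNIV. indicator (X i) (x $ i) :: ennreal)" for x
  proof (cases "\<forall>i. x $ i \<in> X i")
    case False
    then obtain i where "x $ i \<notin> X i" by auto
    then have "(\<Prod>i\<in>UNIV. indicator (X i) (x $ i) :: ennreal) = 0"
      by (intro prod_zero bexI[of _ i]) auto
    with False show ?thesis by simp
  qed auto
  have "emeasure (normal_vec \<sigma>) {x. \<forall>i. x $ i \<in> X i} =
     (\<integral>\<^sup>+x. (\<Prod>i\<in>UNIV. ennreal (normal_density 0 (\<sigma> i) (x $ i))) * indicator {x. \<forall>i. x $ i \<in> X i} x \<partial>lborel)"
    unfolding normal_vec_def by (subst emeasure_density) auto
  also have "\<dots> = (\<integral>\<^sup>+x. (\<Prod>i\<in>UNIV. ennreal (normal_density 0 (\<sigma> i) (x $ i)) * indicator (X i) (x $ i)) \<partial>lborel)"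
    by (simp add: ind prod.distrib)
  also have "\<dots> = (\<Prod>i\<in>UNIV. \<integral>\<^sup>+x. ennreal (normal_density 0 (\<sigma> i) x) * indicator (X i) x \<partial>lborel)"
    by (rule nn_integral_lborel_vec_prod[where f = "\<lambda>i x. ennreal (normal_density 0 (\<sigma> i) x) * indicator (X i) x"]) simp
  also have "\<dots> = (\<Prod>i\<in>UNIV. emeasure (density lborel (normal_density 0 (\<sigma> i))) (X i))"
    by (intro prod.cong) (auto simp: emeasure_density)
  finally show ?thesis .
qed

lemma normal_vec_eq_distr_PiM:
  assumes "\<And>i. \<sigma> i > 0"
  shows "normal_vec \<sigma> = distr (PiM UNIV (\<lambda>i. density lborel (normal_density 0 (\<sigma> i)))) borel (\<lambda>f. \<chi> i. f i)"
  using assms emeasure_normal_vec_box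
  by (intro measure_vec_eqI_prod)
     (auto intro!: prob_space_imp_sigma_finite prob_space_normal_density)

lemma prob_space_normal_vec:
  assumes "\<And>i. \<sigma> i > 0"
  shows "prob_space (normal_vec \<sigma>)"
proof
  interpret prob_space "density lborel (normal_density 0 (\<sigma> i))" for i
    using assms by (rule prob_space_normal_density)
  show "emeasure (normal_vec \<sigma>) (space (normal_vec \<sigma>)) = 1"
    using emeasure_normal_vec_box[of "\<lambda>_. UNIV" \<sigma>] emeasure_space_1 by simp
qed

text \<open>The preimage of a box under a coordinatewise scaling is a box, which leaves the
  one-dimensional affine rule for normal densities.\<close>

lemma distr_normal_vec_scale:
  fixes \<tau> :: "'i::finite \<Rightarrow> real"
  assumes \<tau>: "\<And>i. \<tau> i > 0"
  shows "distr (normal_vec (\<lambda>_. 1)) borel (\<lambda>x. \<chi> i. \<tau> i * x $ i) = normal_vec \<tau>"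
proof -
  have [measurable]: "(\<lambda>x::real^'i. \<chi> i. \<tau> i * x $ i) \<in> borel_measurable borel"
    by (intro borel_measurable_continuous_onI continuous_intros)
  have scale: "emeasure (density lborel (normal_density 0 1)) {x. \<tau> i * x \<in> X} =
      emeasure (density lborel (normal_density 0 (\<tau> i))) X" if [measurable]: "X \<in> sets borel" for i X
  proof -
    interpret prob_space "density lborel (normal_density 0 1)" by (rule prob_space_normal_density) simp
    have "distributed (density lborel (normal_density 0 1)) lborel (\<lambda>x. x) (normal_density 0 1)"
      by (auto simp: distributed_def distr_id2)
    from normal_density_affine[OF this, of "\<tau> i" 0] \<tau>[of i]
    have "density lborel (normal_density 0 (\<tau> i)) = distr (density lborel (normal_density 0 1)) lborel (\<lambda>x. \<tau> i * x)"
      by (auto simp: distributed_def)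
    then show ?thesis
      by (simp add: emeasure_distr vimage_def)
  qed
  have "distr (normal_vec (\<lambda>_. 1)) borel (\<lambda>x. \<chi> i. \<tau> i * x $ i) =
    distr (PiM UNIV (\<lambda>i. density lborel (normal_density 0 (\<tau> i)))) borel (\<lambda>f. \<chi> i. f i)"
  proof (rule measure_vec_eqI_prod)
    fix X :: "'i \<Rightarrow> real set" assume [measurable]: "\<And>i. X i \<in> sets borel"
    have "emeasure (distr (normal_vec (\<lambda>_. 1)) borel (\<lambda>x. \<chi> i. \<tau> i * x $ i)) {x. \<forall>i. x $ i \<in> X i} =
        emeasure (normal_vec (\<lambda>_. 1)) {x. \<forall>i. x $ i \<in> {z. \<tau> i * z \<in> X i}}"
      by (subst emeasure_distr) (auto simp: vimage_def)
    also have "\<dots> = (\<Prod>i\<in>UNIV. emeasure (density lborel (normal_density 0 (\<tau> i))) (X i))"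
      by (subst emeasure_normal_vec_box) (auto simp: scale)
    finally show "emeasure (distr (normal_vec (\<lambda>_. 1)) borel (\<lambda>x. \<chi> i. \<tau> i * x $ i)) {x. \<forall>i. x $ i \<in> X i} =
       (\<Prod>i\<in>UNIV. emeasure (density lborel (normal_density 0 (\<tau> i))) (X i))" .
  qed (auto intro!: prob_space_imp_sigma_finite prob_space_normal_density \<tau>)
  then show ?thesis
    using normal_vec_eq_distr_PiM[of \<tau>] \<tau> by simp
qed

section \<open>Rotation invariance of Lebesgue measure and of the standard Gaussian\<close>

lemma borel_measurable_linear:
  fixes f :: "'a::euclidean_space \<Rightarrow> 'b::euclidean_space"
  shows "linear f \<Longrightarrow> f \<in> borel_measurable borel"
  by (intro borel_measurable_continuous_onI linear_continuous_on) (simp add: linear_linear)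

text \<open>Both measures are translation invariant and agree on the unit ball, so the Fubini argument
  for the uniqueness of Haar measure identifies them.\<close>
lemma distr_lborel_orthogonal:
  fixes T :: "'a::euclidean_space \<Rightarrow> 'a"
  assumes T: "orthogonal_transformation T"
  shows "distr lborel borel T = lborel"
proof (rule measure_eqI)
  let ?\<mu> = "distr lborel borel T"
  have lin: "linear T" by (rule orthogonal_transformation_linear[OF T])
  have [measurable]: "T \<in> borel_measurable borel"
    using lin by (rule borel_measurable_linear)
  have Tinv: "T (inv T y) = y" for y
    by (simp add: orthogonal_transformation_surj[OF T] surj_f_inv_f)
  have shift: "(\<integral>\<^sup>+x. f (y + x) \<partial>lborel) = (\<integral>\<^sup>+x. f x \<partial>lborel)"
    if [measurable]: "f \<in> borel_measurable borel" for f :: "'a \<Rightarrow> ennreal" and y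
    by (subst (2) lborel_distr_plus[of y, symmetric]) (simp add: nn_integral_distr)
  \<comment> \<open>By linearity, a shift by \<open>y\<close> after \<open>T\<close> is a shift by
    \<open>inv T y\<close> before it.\<close>
  have shift\<mu>: "(\<integral>\<^sup>+x. f (y + x) \<partial>?\<mu>) = (\<integral>\<^sup>+x. f x \<partial>?\<mu>)"
    if [measurable]: "f \<in> borel_measurable borel" for f :: "'a \<Rightarrow> ennreal" and y
  proof -
    have "(\<integral>\<^sup>+x. f (y + x) \<partial>?\<mu>) = (\<integral>\<^sup>+x. f (T (inv T y + x)) \<partial>lborel)"
      by (simp add: nn_integral_distr linear_add[OF lin] Tinv)
    also have "\<dots> = (\<integral>\<^sup>+x. f (T x) \<partial>lborel)"
      by (rule shift[of "\<lambda>x. f (T x)"]) simp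
    finally show ?thesis by (simp add: nn_integral_distr)
  qed
  let ?B = "ball 0 1 :: 'a set"
  have [measurable]: "?B \<in> sets borel" by simp
  have iB: "indicator ?B \<in> borel_measurable (borel :: 'a measure)"
    by (rule borel_measurable_indicator) simp
  have B: "emeasure ?\<mu> ?B = emeasure lborel ?B"
    by (auto simp: emeasure_distr vimage_def orthogonal_transformation_norm[OF T] mem_ball_0
        intro!: arg_cong[of _ _ "emeasure lborel"])
  have fin: "emeasure lborel ?B \<noteq> \<infinity>" "emeasure lborel ?B \<noteq> 0"
    using content_ball_gt_0_iff[of "0::'a" 1] emeasure_lborel_ball_finite[of "0::'a" 1]
    by (auto simp: measure_def simp del: content_ball_gt_0_iff)
  have sf\<mu>: "sigma_finite_measure ?\<mu>"
  proof (rule sigma_finite_measure_distr)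
    have "linear (inv T)"
      using orthogonal_transformation_inv[OF T] by (rule orthogonal_transformation_linear)
    then have [measurable]: "inv T \<in> borel_measurable borel"
      by (rule borel_measurable_linear)
    have "distr ?\<mu> lborel (inv T) = lborel"
      by (simp add: distr_distr comp_def inv_f_f orthogonal_transformation_inj[OF T] distr_id2)
    then show "sigma_finite_measure (distr ?\<mu> lborel (inv T))"
      by (simp add: sigma_finite_lborel)
    show "inv T \<in> ?\<mu> \<rightarrow>\<^sub>M lborel" by simp
  qed
  interpret pair_sigma_finite lborel ?\<mu>
    using sf\<mu> by (intro pair_sigma_finite.intro sigma_finite_lborel)
  fix S assume "S \<in> sets ?\<mu>"
  then have [measurable]: "S \<in> sets borel" by simp
  have "emeasure ?\<mu> S * emeasure lborel ?B = (\<integral>\<^sup>+x. indicator S x * emeasure lborel ?B \<partial>?\<mu>)"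
    by (simp add: nn_integral_multc)
  also have "\<dots> = (\<integral>\<^sup>+x. indicator S x * (\<integral>\<^sup>+y. indicator ?B (- x + y) \<partial>lborel) \<partial>?\<mu>)"
    by (subst shift[OF iB]) simp
  also have "\<dots> = (\<integral>\<^sup>+x. (\<integral>\<^sup>+y. indicator S x * indicator ?B (- x + y) \<partial>lborel) \<partial>?\<mu>)"
    by (intro nn_integral_cong nn_integral_cmult[symmetric]) measurable
  also have "\<dots> = (\<integral>\<^sup>+y. (\<integral>\<^sup>+x. indicator S x * indicator ?B (- x + y) \<partial>?\<mu>) \<partial>lborel)"
    by (rule Fubini') measurable
  \<comment> \<open>Shifting \<open>x\<close> by \<open>y\<close> under \<open>?\<mu>\<close> leaves
    \<open>- x\<close> in the ball indicator; since the ball is symmetric, \<open>y\<close> then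
    occurs only in the indicator of \<open>S\<close>.\<close>
  also have "\<dots> = (\<integral>\<^sup>+y. (\<integral>\<^sup>+x. indicator S (y + x) * indicator ?B (- (y + x) + y) \<partial>?\<mu>) \<partial>lborel)"
    by (intro nn_integral_cong shift\<mu>[symmetric]) measurable
  also have "\<dots> = (\<integral>\<^sup>+y. (\<integral>\<^sup>+x. indicator S (x + y) * indicator ?B x \<partial>?\<mu>) \<partial>lborel)"
    by (intro nn_integral_cong) (auto simp: indicator_def add.commute)
  also have "\<dots> = (\<integral>\<^sup>+x. (\<integral>\<^sup>+y. indicator S (x + y) * indicator ?B x \<partial>lborel) \<partial>?\<mu>)"
    by (rule Fubini'[symmetric]) measurable
  also have "\<dots> = (\<integral>\<^sup>+x. emeasure lborel S * indicator ?B x \<partial>?\<mu>)"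
    by (intro nn_integral_cong) (simp add: nn_integral_multc shift)
  also have "\<dots> = emeasure lborel S * emeasure lborel ?B"
    by (simp add: nn_integral_cmult B)
  finally have "emeasure ?\<mu> S * emeasure lborel ?B / emeasure lborel ?B = emeasure lborel S * emeasure lborel ?B / emeasure lborel ?B"
    by simp
  then show "emeasure ?\<mu> S = emeasure lborel S"
    using fin by (simp add: ennreal_mult_divide_eq)
qed simp

text \<open>The standard density depends on the norm alone, and \<open>T\<close> preserves both the
  norm and Lebesgue measure.\<close>

lemma distr_normal_vec_orthogonal:
  fixes T :: "real ^ 'i::finite \<Rightarrow> real ^ 'i"
  assumes T: "orthogonal_transformation T"
  shows "distr (normal_vec (\<lambda>_. 1)) borel T = normal_vec (\<lambda>_. 1)"
proof -
  let ?f = "\<lambda>x::real^'i. \<Prod>i\<in>UNIV. ennreal (normal_density 0 1 (x $ i))"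
  have [measurable]: "T \<in> borel_measurable borel"
    by (simp add: T orthogonal_transformation_linear borel_measurable_linear)
  have f: "?f x = ennreal ((1 / sqrt (2 * pi)) ^ CARD('i) * exp (- (norm x)\<^sup>2 / 2))" for x
  proof -
    have "(\<Prod>i\<in>UNIV. normal_density 0 1 (x $ i)) = (1 / sqrt (2 * pi)) ^ CARD('i) * (\<Prod>i\<in>UNIV. exp (- (x $ i)\<^sup>2 / 2))"
      by (simp add: normal_density_def prod_dividef power_divide)
    also have "(\<Prod>i\<in>UNIV. exp (- (x $ i)\<^sup>2 / 2)) = exp (- (norm x)\<^sup>2 / 2)"
      by (simp add: exp_sum[symmetric] norm_vec_def L2_set_def sum_nonneg sum_divide_distrib sum_negf)
    finally show ?thesis by (simp add: prod_ennreal)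
  qed
  have fT: "?f (T x) = ?f x" for x
    unfolding f by (simp add: orthogonal_transformation_norm[OF T])
  have "normal_vec (\<lambda>_. 1) = density (distr lborel borel T) ?f"
    by (simp add: normal_vec_def distr_lborel_orthogonal[OF T])
  also have "\<dots> = distr (density lborel (\<lambda>x. ?f (T x))) borel T"
    by (rule density_distr) measurable
  also have "\<dots> = distr (normal_vec (\<lambda>_. 1)) borel T"
    by (simp only: fT normal_vec_def)
  finally show ?thesis ..
qed

subsection \<open>Approximate domination between Gaussians of different variance\<close>

text \<open>The difference of the two sides vanishes at 0 and has derivative
  \<open>z\<^sup>2 / (1 + z)\<close>. This bound and the next one make the Chernoff exponents
  quadratic.\<close>

lemma ln_one_plus_ge_quadratic:
  fixes x :: real
  assumes "0 \<le> x"
  shows "x - x\<^sup>2 / 2 \<le> ln (1 + x)"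
proof -
  let ?f = "\<lambda>x::real. ln (1 + x) - (x - x\<^sup>2 / 2)"
  have "?f 0 \<le> ?f x"
  proof (rule DERIV_nonneg_imp_nondecreasing[OF assms])
    fix z :: real assume z: "0 \<le> z" "z \<le> x"
    have "(?f has_real_derivative (z\<^sup>2 / (1 + z))) (at z)"
      using z by (auto intro!: derivative_eq_intros simp: field_simps power2_eq_square)
    then show "\<exists>y. (?f has_real_derivative y) (at z) \<and> 0 \<le> y"
      using z by (intro exI[of _ "z\<^sup>2 / (1 + z)"]) auto
  qed
  then show ?thesis by simp
qed

lemma one_plus_mult_ln_le_quadratic:
  fixes x :: real
  assumes "0 \<le> x"
  shows "(1 + x) * ln (1 + x) \<le> x + x\<^sup>2 / 2"
proof -
  let ?f = "\<lambda>x::real. x + x\<^sup>2 / 2 - (1 + x) * ln (1 + x)"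
  have "?f 0 \<le> ?f x"
  proof (rule DERIV_nonneg_imp_nondecreasing[OF assms])
    fix z :: real assume z: "0 \<le> z" "z \<le> x"
    have "(?f has_real_derivative (z - ln (1 + z))) (at z)"
      using z by (auto intro!: derivative_eq_intros)
    then show "\<exists>y. (?f has_real_derivative y) (at z) \<and> 0 \<le> y"
      using z ln_add_one_self_le_self[of z] by (intro exI[of _ "z - ln (1 + z)"]) auto
  qed
  then show ?thesis by simp
qed

text \<open>Integrating the pointwise bound over \<open>S\<close> suffices: the \<open>h\<close>
  part has mass at most 1, so \<open>d\<close> becomes the additive error.\<close>

lemma density_approx_dominated:
  fixes f g h :: "'a \<Rightarrow> ennreal"
  assumes [measurable]: "f \<in> borel_measurable M" "g \<in> borel_measurable M" "h \<in> borel_measurable M"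
    and f: "prob_space (density M f)" and g: "prob_space (density M g)" and h: "prob_space (density M h)"
    and c: "0 \<le> c" and d: "0 \<le> d"
    and le: "\<And>x. f x \<le> ennreal c * g x + ennreal d * h x"
    and S[measurable]: "S \<in> sets M"
  shows "measure (density M f) S \<le> c * measure (density M g) S + d"
proof -
  interpret f: prob_space "density M f" by fact
  interpret g: prob_space "density M g" by fact
  interpret h: prob_space "density M h" by fact
  have "emeasure (density M f) S = (\<integral>\<^sup>+x. f x * indicator S x \<partial>M)"
    by (rule emeasure_density) measurable
  also have "\<dots> \<le> (\<integral>\<^sup>+x. c * (g x * indicator S x) + d * (h x * indicator S x) \<partial>M)"
    by (intro nn_integral_mono) (auto simp: indicator_def le)
  also have "\<dots> = c * emeasure (density M g) S + d * emeasure (density M h) S"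
    by (simp add: nn_integral_add nn_integral_cmult emeasure_density)
  also have "\<dots> \<le> c * emeasure (density M g) S + ennreal d * 1"
    by (intro add_left_mono mult_left_mono h.emeasure_le_1) simp
  also have "\<dots> = ennreal (c * measure (density M g) S + d)"
    using c d by (simp add: g.emeasure_eq_measure ennreal_mult)
  finally show ?thesis
    using c d by (simp add: f.emeasure_eq_measure del: ennreal_plus)
qed

text \<open>The parameter \<open>v\<close> is a variance, the value a standard deviation.\<close>
definition block_scale :: "'i set \<Rightarrow> real \<Rightarrow> 'i \<Rightarrow> real" where
  "block_scale J v i = (if i \<in> J then sqrt v else 1)"

lemma block_scale_pos: "0 < v \<Longrightarrow> 0 < block_scale J v i"
  by (simp add: block_scale_def)

text \<open>\<open>C\<close> collects every factor free of the variance \<open>v\<close>, so that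
  densities for different variances compare through exponents that depend on \<open>x\<close> only
  via half the squared norm on \<open>J\<close>.\<close>

lemma normal_vec_block_density:
  fixes J :: "'i::finite set"
  obtains C where "\<And>x. 0 \<le> C x" and
    "\<And>v x. 0 < v \<Longrightarrow> (\<Prod>i\<in>UNIV. ennreal (normal_density 0 (block_scale J v i) (x $ i))) =
      ennreal (C x * exp (- (real (card J) / 2) * ln v - (\<Sum>i\<in>J. (x $ i)\<^sup>2 / 2) / v))"
proof
  let ?C = "\<lambda>x::real^'i. (\<Prod>i\<in>J. 1 / sqrt (2 * pi)) * (\<Prod>i\<in>-J. normal_density 0 1 (x $ i))"
  show "0 \<le> ?C x" for x
    by (intro mult_nonneg_nonneg prod_nonneg) auto
  fix v :: real and x :: "real ^ 'i" assume v: "0 < v"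
  \<comment> \<open>The normalising factor \<open>1 / sqrt v\<close> is moved into the exponent as
    \<open>- (1 / 2) * ln v\<close>.\<close>
  have nd: "normal_density 0 (sqrt v) z = 1 / sqrt (2 * pi) * exp (- (1 / 2) * ln v - z\<^sup>2 / 2 / v)" for z
  proof -
    have "exp (- (1 / 2) * ln v) = inverse (exp (ln v / 2))"
      by (simp add: exp_minus)
    also have "exp (ln v / 2) = sqrt v"
      using v by (simp add: ln_sqrt[symmetric])
    finally have "exp (- (1 / 2) * ln v) = inverse (sqrt v)" .
    then have e: "exp (- (1 / 2) * ln v - z\<^sup>2 / 2 / v) = inverse (sqrt v) * exp (- (z\<^sup>2 / 2 / v))"
      by (simp only: diff_conv_add_uminus exp_add)
    have "sqrt (2 * pi * (sqrt v)\<^sup>2) = sqrt (2 * pi) * sqrt v" "- (z - 0)\<^sup>2 / (2 * (sqrt v)\<^sup>2) = - (z\<^sup>2 / 2 / v)"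
      using v by (simp_all add: real_sqrt_mult)
    then show ?thesis
      unfolding e normal_density_def by (simp only: inverse_eq_divide) simp
  qed
  have "(\<Prod>i\<in>UNIV. normal_density 0 (block_scale J v i) (x $ i)) =
     (\<Prod>i\<in>J. normal_density 0 (block_scale J v i) (x $ i)) * (\<Prod>i\<in>-J. normal_density 0 (block_scale J v i) (x $ i))"
    by (subst prod.union_disjoint[symmetric]) auto
  also have "\<dots> = (\<Prod>i\<in>J. 1 / sqrt (2 * pi) * exp (- (1 / 2) * ln v - (x $ i)\<^sup>2 / 2 / v)) * (\<Prod>i\<in>-J. normal_density 0 1 (x $ i))"
    by (simp add: block_scale_def nd)
  also have "\<dots> = ?C x * (\<Prod>i\<in>J. exp (- (1 / 2) * ln v - (x $ i)\<^sup>2 / 2 / v))"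
    by (simp only: prod.distrib mult.commute mult.left_commute)
  also have "(\<Prod>i\<in>J. exp (- (1 / 2) * ln v - (x $ i)\<^sup>2 / 2 / v)) = exp (- (real (card J) / 2) * ln v - (\<Sum>i\<in>J. (x $ i)\<^sup>2 / 2) / v)"
    by (subst exp_sum[symmetric]) (simp_all only: finite sum_subtractf sum_constant sum_divide_distrib, simp)
  finally show "(\<Prod>i\<in>UNIV. ennreal (normal_density 0 (block_scale J v i) (x $ i))) =
      ennreal (?C x * exp (- (real (card J) / 2) * ln v - (\<Sum>i\<in>J. (x $ i)\<^sup>2 / 2) / v))"
    by (simp add: prod_ennreal)
qed

text \<open>With the common factor cancelled, \<open>y\<close> stands for half the squared norm on
  \<open>J\<close>. Each point is covered by one of two densities, hence by their sum, and the third
  Gaussian of variance \<open>z\<close> contributes at most \<open>exp (- t)\<close>.\<close>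

lemma normal_vec_block_approx_dominated:
  fixes J :: "'i::finite set"
  assumes pos: "0 < u" "0 < v" "0 < z"
    and le: "\<And>y. 0 \<le> y \<Longrightarrow>
      - (real (card J) / 2) * ln u - y / u \<le> \<epsilon> - (real (card J) / 2) * ln v - y / v \<or>
      - (real (card J) / 2) * ln u - y / u \<le> - t - (real (card J) / 2) * ln z - y / z"
    and S: "S \<in> sets borel"
  shows "measure (normal_vec (block_scale J u)) S \<le> exp \<epsilon> * measure (normal_vec (block_scale J v)) S + exp (- t)"
proof -
  obtain C where C: "\<And>x. 0 \<le> C x" and
    D: "\<And>v x. 0 < v \<Longrightarrow> (\<Prod>i\<in>UNIV. ennreal (normal_density 0 (block_scale J v i) (x $ i))) =
      ennreal (C x * exp (- (real (card J) / 2) * ln v - (\<Sum>i\<in>J. (x $ i)\<^sup>2 / 2) / v))"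
    using normal_vec_block_density[of J] by blast
  have prob: "prob_space (density lborel (\<lambda>x. \<Prod>i\<in>UNIV. ennreal (normal_density 0 (block_scale J v i) (x $ i))))"
    if "0 < v" for v
    using prob_space_normal_vec[OF block_scale_pos[OF that]] unfolding normal_vec_def .
  show ?thesis
    unfolding normal_vec_def
  proof (rule density_approx_dominated[where h = "\<lambda>x. \<Prod>i\<in>UNIV. ennreal (normal_density 0 (block_scale J z i) (x $ i))"])
    fix x :: "real ^ 'i"
    define y where "y = (\<Sum>i\<in>J. (x $ i)\<^sup>2 / 2)"
    define q where "q v = - (real (card J) / 2) * ln v - y / v" for v
    have "0 \<le> y" unfolding y_def by (intro sum_nonneg) simp
    then have "q u \<le> \<epsilon> + q v \<or> q u \<le> - t + q z"
      using le[of y] by (simp add: q_def algebra_simps)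
    then have "exp (q u) \<le> exp \<epsilon> * exp (q v) + exp (- t) * exp (q z)"
      unfolding exp_add[symmetric] by (smt (verit) exp_ge_zero exp_le_cancel_iff)
    then have "C x * exp (q u) \<le> C x * (exp \<epsilon> * exp (q v) + exp (- t) * exp (q z))"
      using C[of x] by (rule mult_left_mono)
    then have "ennreal (C x * exp (q u)) \<le> ennreal (exp \<epsilon> * (C x * exp (q v)) + exp (- t) * (C x * exp (q z)))"
      by (intro ennreal_leI) (simp add: algebra_simps)
    also have "\<dots> = ennreal (exp \<epsilon>) * ennreal (C x * exp (q v)) + ennreal (exp (- t)) * ennreal (C x * exp (q z))"
      using C[of x] by (simp add: ennreal_plus ennreal_mult)
    finally show "(\<Prod>i\<in>UNIV. ennreal (normal_density 0 (block_scale J u i) (x $ i)))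
         \<le> ennreal (exp \<epsilon>) * (\<Prod>i\<in>UNIV. ennreal (normal_density 0 (block_scale J v i) (x $ i)))
          + ennreal (exp (- t)) * (\<Prod>i\<in>UNIV. ennreal (normal_density 0 (block_scale J z i) (x $ i)))"
      unfolding D[OF pos(1)] D[OF pos(2)] D[OF pos(3)] q_def y_def .
  qed (use S prob[OF pos(1)] prob[OF pos(2)] prob[OF pos(3)] in auto)
qed

text \<open>Identities for the tilt \<open>2 * sqrt (t / m)\<close>, with which the Chernoff
  estimates below close without loss.\<close>

lemma
  fixes m t :: real
  assumes "0 < m" "0 < t"
  shows chernoff_param_sq: "m * (2 * sqrt (t / m))\<^sup>2 / 4 = t"
    and chernoff_param_mult: "sqrt (m * t) * (2 * sqrt (t / m)) = 2 * t"
  using assms by (auto simp: power_mult_distrib real_sqrt_mult[symmetric])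

text \<open>The third Gaussian in the domination is the exponential tilt optimising the Chernoff
  bound for the chi-squared tail with \<open>card J\<close> degrees of freedom.\<close>

lemma normal_vec_inflated_approx_dominated:
  fixes J :: "'i::finite set"
  assumes J: "J \<noteq> {}" and \<alpha>: "0 \<le> \<alpha>" "\<alpha> \<le> \<eta>" and t: "0 < t"
    and \<epsilon>: "\<epsilon> = \<eta> * (real (card J) * \<eta> / 4 + sqrt (real (card J) * t) + t)"
    and S: "S \<in> sets borel"
  shows "measure (normal_vec (block_scale J (1 + \<alpha>))) S \<le> exp \<epsilon> * measure (normal_vec (block_scale J 1)) S + exp (- t)"
proof -
  define m where "m = real (card J)"
  define \<mu> where "\<mu> = 2 * sqrt (t / m)"
  have m: "0 < m" using J by (simp add: m_def card_gt_0_iff)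
  have \<mu>: "0 < \<mu>" using t m by (simp add: \<mu>_def)
  have \<mu>1: "m * \<mu>\<^sup>2 / 4 = t" and \<mu>2: "sqrt (m * t) * \<mu> = 2 * t"
    using chernoff_param_sq[OF m t] chernoff_param_mult[OF m t] by (simp_all add: \<mu>_def)
  have \<epsilon>_ge: "\<alpha> * (m * \<alpha> / 4 + sqrt (m * t) + t) \<le> \<epsilon>"
    unfolding \<epsilon> m_def[symmetric] using \<alpha> m t by (intro mult_mono add_mono) auto
  have \<epsilon>0: "0 \<le> \<epsilon>"
    using \<epsilon>_ge \<alpha> m t by (smt (verit) divide_nonneg_pos mult_nonneg_nonneg real_sqrt_ge_zero)
  show ?thesis
  proof (rule normal_vec_block_approx_dominated[where z = "(1 + \<alpha>) * (1 + \<mu>)"])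
    fix y :: real assume y: "0 \<le> y"
    define z where "z = y / (1 + \<alpha>)"
    have "(1 + \<alpha>) * z = y" using \<alpha> by (simp add: z_def)
    then have yz: "y = z + \<alpha> * z" by (simp add: algebra_simps)
    \<comment> \<open>The premise is the failure of the first alternative, the conclusion is the
      second. The premise forces \<open>z\<close> beyond \<open>m / 2 + sqrt (m * t) + t\<close>,
      the Laurent-Massart threshold for half a chi-squared variable.\<close>
    have tail: "t + (m / 2) * ln (1 + \<mu>) \<le> z * \<mu> / (1 + \<mu>)" if "\<epsilon> + (m / 2) * ln (1 + \<alpha>) < \<alpha> * z"
    proof -
      have "0 \<le> (m / 2) * ln (1 + \<alpha>)" using m \<alpha> by simp
      then have "\<alpha> \<noteq> 0" using that \<epsilon>0 by auto
      then have \<alpha>0: "0 < \<alpha>" using \<alpha> by simp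
      have "(m / 2) * (\<alpha> - \<alpha>\<^sup>2 / 2) \<le> (m / 2) * ln (1 + \<alpha>)"
        using ln_one_plus_ge_quadratic[OF \<alpha>(1)] m by (intro mult_left_mono) auto
      then have "\<alpha> * (sqrt (m * t) + t + m / 2) < \<alpha> * z"
        using that \<epsilon>_ge by (simp add: algebra_simps power2_eq_square)
      then have "sqrt (m * t) + t + m / 2 \<le> z"
        using \<alpha>0 by simp
      then have "(sqrt (m * t) + t + m / 2) * \<mu> \<le> z * \<mu>"
        using \<mu> by (intro mult_right_mono) auto
      moreover have "(m / 2) * ((1 + \<mu>) * ln (1 + \<mu>)) \<le> (m / 2) * (\<mu> + \<mu>\<^sup>2 / 2)"
        using one_plus_mult_ln_le_quadratic[of \<mu>] \<mu> m by (intro mult_left_mono) auto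
      \<comment> \<open>By \<open>\<mu>1\<close> and \<open>\<mu>2\<close> both estimates meet at
        \<open>2 * t + t * \<mu> + m * \<mu> / 2\<close>.\<close>
      ultimately have "(t + (m / 2) * ln (1 + \<mu>)) * (1 + \<mu>) \<le> z * \<mu>"
        using \<mu>1 \<mu>2 by (simp add: algebra_simps add_divide_distrib)
      then show ?thesis using \<mu> by (simp add: pos_le_divide_eq)
    qed
    have z_eq: "z * \<mu> / (1 + \<mu>) = z - y / ((1 + \<alpha>) * (1 + \<mu>))"
    proof -
      have "y / ((1 + \<alpha>) * (1 + \<mu>)) = z / (1 + \<mu>)" by (simp add: z_def)
      then show ?thesis using \<mu> by (simp add: field_simps)
    qed
    have "ln ((1 + \<alpha>) * (1 + \<mu>)) = ln (1 + \<alpha>) + ln (1 + \<mu>)"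
      using \<alpha> \<mu> by (intro ln_mult_pos) auto
    then have ln_eq: "(m / 2) * ln ((1 + \<alpha>) * (1 + \<mu>)) = (m / 2) * ln (1 + \<alpha>) + (m / 2) * ln (1 + \<mu>)"
      by (simp only: distrib_left)
    show "- (real (card J) / 2) * ln (1 + \<alpha>) - y / (1 + \<alpha>) \<le> \<epsilon> - (real (card J) / 2) * ln 1 - y / 1 \<or>
      - (real (card J) / 2) * ln (1 + \<alpha>) - y / (1 + \<alpha>) \<le> - t - (real (card J) / 2) * ln ((1 + \<alpha>) * (1 + \<mu>)) - y / ((1 + \<alpha>) * (1 + \<mu>))"
      unfolding m_def[symmetric] z_def[symmetric] ln_one div_by_1 mult_minus_left
      using yz tail z_eq ln_eq by linarith
  qed (use \<alpha> \<mu> S in auto)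
qed

text \<open>The lower-tail counterpart: the tilt now shrinks the variance to
  \<open>1 / (1 + \<mu>)\<close>, and the threshold \<open>m / 2 - sqrt (m * t)\<close> has no
  linear term, so the summand \<open>t\<close> disappears from \<open>\<epsilon>\<close>.\<close>

lemma normal_vec_deflated_approx_dominated:
  fixes J :: "'i::finite set"
  assumes J: "J \<noteq> {}" and \<alpha>: "0 \<le> \<alpha>" "\<alpha> \<le> \<eta>" and t: "0 < t"
    and \<epsilon>: "\<epsilon> = \<eta> * (real (card J) * \<eta> / 4 + sqrt (real (card J) * t))"
    and S: "S \<in> sets borel"
  shows "measure (normal_vec (block_scale J 1)) S \<le> exp \<epsilon> * measure (normal_vec (block_scale J (1 + \<alpha>))) S + exp (- t)"
proof -
  define m where "m = real (card J)"
  define \<mu> where "\<mu> = 2 * sqrt (t / m)"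
  have m: "0 < m" using J by (simp add: m_def card_gt_0_iff)
  have \<mu>: "0 < \<mu>" using t m by (simp add: \<mu>_def)
  have \<mu>1: "m * \<mu>\<^sup>2 / 4 = t" and \<mu>2: "sqrt (m * t) * \<mu> = 2 * t"
    using chernoff_param_sq[OF m t] chernoff_param_mult[OF m t] by (simp_all add: \<mu>_def)
  have \<epsilon>_ge: "\<alpha> * (m * \<alpha> / 4 + sqrt (m * t)) \<le> \<epsilon>"
    unfolding \<epsilon> m_def[symmetric] using \<alpha> m t by (intro mult_mono add_mono) auto
  have \<epsilon>0: "0 \<le> \<epsilon>"
    using \<epsilon>_ge \<alpha> m t by (smt (verit) divide_nonneg_pos mult_nonneg_nonneg real_sqrt_ge_zero)
  show ?thesis
  proof (rule normal_vec_block_approx_dominated[where z = "1 / (1 + \<mu>)"])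
    fix y :: real assume y: "0 \<le> y"
    define z where "z = y / (1 + \<alpha>)"
    have "(1 + \<alpha>) * z = y" using \<alpha> by (simp add: z_def)
    then have yz: "y = z + \<alpha> * z" by (simp add: algebra_simps)
    \<comment> \<open>Again the failure of the first alternative implies the second. The two
      logarithm bounds exchange roles: the one for \<open>(1 + x) * ln (1 + x)\<close> is applied to
      \<open>\<alpha>\<close>, the other to \<open>\<mu>\<close>.\<close>
    have tail: "y * \<mu> \<le> (m / 2) * ln (1 + \<mu>) - t" if "\<alpha> * z < (m / 2) * ln (1 + \<alpha>) - \<epsilon>"
    proof -
      have "\<alpha> \<noteq> 0" using that \<epsilon>0 by auto
      then have \<alpha>0: "0 < \<alpha>" using \<alpha> by simp
      have "\<alpha> * y = (1 + \<alpha>) * (\<alpha> * z)"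
        by (simp add: yz algebra_simps)
      also have "\<dots> < (1 + \<alpha>) * ((m / 2) * ln (1 + \<alpha>) - \<epsilon>)"
        using that \<alpha> by (intro mult_strict_left_mono) auto
      also have "\<dots> \<le> (m / 2) * ((1 + \<alpha>) * ln (1 + \<alpha>)) - \<epsilon>"
        using \<alpha> \<epsilon>0 by (simp add: algebra_simps)
      also have "\<dots> \<le> (m / 2) * (\<alpha> + \<alpha>\<^sup>2 / 2) - \<alpha> * (m * \<alpha> / 4 + sqrt (m * t))"
        using one_plus_mult_ln_le_quadratic[OF \<alpha>(1)] m \<epsilon>_ge
        by (intro diff_mono mult_left_mono) auto
      also have "\<dots> = \<alpha> * (m / 2 - sqrt (m * t))"
        by (simp add: algebra_simps power2_eq_square)
      finally have "y \<le> m / 2 - sqrt (m * t)"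
        using \<alpha>0 by simp
      then have "y * \<mu> \<le> (m / 2 - sqrt (m * t)) * \<mu>"
        using \<mu> by (intro mult_right_mono) auto
      moreover have "(m / 2) * (\<mu> - \<mu>\<^sup>2 / 2) \<le> (m / 2) * ln (1 + \<mu>)"
        using ln_one_plus_ge_quadratic[of \<mu>] \<mu> m by (intro mult_left_mono) auto
      ultimately show ?thesis
        using \<mu>1 \<mu>2 by (simp add: algebra_simps)
    qed
    have "ln (1 / (1 + \<mu>)) = - ln (1 + \<mu>)"
      using \<mu> by (simp add: ln_div)
    then have ln_eq: "(m / 2) * ln (1 / (1 + \<mu>)) = - ((m / 2) * ln (1 + \<mu>))"
      by simp
    have y_eq: "y / (1 / (1 + \<mu>)) = y + y * \<mu>"
      by (simp add: algebra_simps)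
    show "- (real (card J) / 2) * ln 1 - y / 1 \<le> \<epsilon> - (real (card J) / 2) * ln (1 + \<alpha>) - y / (1 + \<alpha>) \<or>
      - (real (card J) / 2) * ln 1 - y / 1 \<le> - t - (real (card J) / 2) * ln (1 / (1 + \<mu>)) - y / (1 / (1 + \<mu>))"
      unfolding m_def[symmetric] z_def[symmetric] y_eq ln_one div_by_1 mult_minus_left
      using yz tail ln_eq by linarith
  qed (use \<alpha> \<mu> S in auto)
qed

subsection \<open>The least singular value\<close>

lemma inner_transpose_mult: "(transpose A *v x) \<bullet> y = x \<bullet> (A *v y)" for A :: "real ^ 'd ^ 'n"
  by (simp add: transpose_matrix_vector dot_lmul_matrix)

text \<open>A minimiser \<open>v0\<close> of the quadratic form on the unit sphere is an eigenvector
  of the Gram matrix, so the minimum \<open>l\<close> is an eigenvalue and bounds the infimum in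
  \<open>sigma_min\<close> from above.\<close>

lemma sigma_min_lower_bound:
  fixes A :: "real ^ 'd ^ 'n"
  assumes w: "0 \<le> w" "w \<le> sigma_min A"
  shows "w\<^sup>2 * (v \<bullet> v) \<le> (A *v v) \<bullet> (A *v v)"
proof -
  define f where "f v = (A *v v) \<bullet> (A *v v)" for v
  define E where "E = {l. \<exists>v :: real ^ 'd. v \<noteq> 0 \<and> (transpose A ** A) *v v = l *s v}"
  have f0: "0 \<le> f v" for v by (simp add: f_def)
  have M: "((transpose A ** A) *v x) \<bullet> y = (A *v x) \<bullet> (A *v y)" for x y
    by (simp add: matrix_vector_mul_assoc[symmetric] dot_lmul_matrix)
  have "continuous_on (sphere 0 1) f"
    unfolding f_def by (intro continuous_intros linear_continuous_on) (simp add: linear_linear)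
  moreover have "sphere (0::real^'d) 1 \<noteq> {}"
    by (metis norm_axis_1 dist_0_norm emptyE mem_sphere)
  ultimately obtain v0 where v0: "v0 \<in> sphere 0 1" and min: "\<And>v. v \<in> sphere 0 1 \<Longrightarrow> f v0 \<le> f v"
    using continuous_attains_inf[OF compact_sphere] by blast
  define l where "l = f v0"
  have v01: "v0 \<bullet> v0 = 1" using v0 by (simp add: norm_eq_1)
  have ge: "l * (v \<bullet> v) \<le> f v" for v
  proof (cases "v = 0")
    case False
    have "l \<le> f ((1 / norm v) *\<^sub>R v)"
      unfolding l_def using False by (intro min) simp
    also have "\<dots> = f v / (v \<bullet> v)"
      by (simp add: f_def matrix_vector_mult_scaleR power2_norm_eq_inner[symmetric] power2_eq_square)
    finally show ?thesis using False by (simp add: pos_le_divide_eq)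
  qed (simp add: f_def)
  \<comment> \<open>The residual of the eigenvalue equation, half the gradient at \<open>v0\<close>
    of the nonnegative form \<open>f v - l * (v \<bullet> v)\<close>; perturbing \<open>v0\<close>
    along \<open>g\<close> shows that it vanishes.\<close>
  define g where "g = (transpose A ** A) *v v0 - l *\<^sub>R v0"
  define c where "c = f g - l * (g \<bullet> g)"
  have c: "0 \<le> c" using ge[of g] by (simp add: c_def)
  have quad: "0 \<le> 2 * t * (g \<bullet> g) + t\<^sup>2 * c" for t
  proof -
    have "f (v0 + t *\<^sub>R g) - l * ((v0 + t *\<^sub>R g) \<bullet> (v0 + t *\<^sub>R g)) = 2 * t * ((A *v v0) \<bullet> (A *v g) - l * (v0 \<bullet> g)) + t\<^sup>2 * c"
      using v01 by (simp add: f_def c_def l_def matrix_vector_right_distrib matrix_vector_mult_scaleR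
          inner_add_left inner_add_right inner_commute power2_eq_square algebra_simps)
    moreover have "(A *v v0) \<bullet> (A *v g) - l * (v0 \<bullet> g) = g \<bullet> g"
      by (subst (3) g_def) (simp add: inner_diff_left M)
    ultimately show ?thesis using ge[of "v0 + t *\<^sub>R g"] by simp
  qed
  have "g \<bullet> g = 0"
  proof (rule ccontr)
    assume "g \<bullet> g \<noteq> 0"
    then have G: "0 < (g \<bullet> g)\<^sup>2 / (c + 1)\<^sup>2" using c by simp
    \<comment> \<open>The perturbation has size \<open>- (g \<bullet> g) / (c + 1)\<close>; the
      shift by 1 covers \<open>c = 0\<close>.\<close>
    have "2 * (- x / k) * x + (- x / k)\<^sup>2 * (k - 1) = x\<^sup>2 / k\<^sup>2 * (- k - 1)" if "k \<noteq> 0" for x k :: real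
      using that by (simp add: field_simps power2_eq_square)
    from this[of "c + 1" "g \<bullet> g"] c have "0 \<le> (g \<bullet> g)\<^sup>2 / (c + 1)\<^sup>2 * (- (c + 1) - 1)"
      using quad[of "- (g \<bullet> g) / (c + 1)"] by simp
    then show False using G c by (smt (verit) mult_pos_neg)
  qed
  then have "(transpose A ** A) *v v0 = l *s v0"
    by (simp add: g_def scalar_mult_eq_scaleR)
  then have lE: "l \<in> E" using v01 unfolding E_def by (intro CollectI exI[of _ v0]) auto
  have E0: "0 \<le> k" if "k \<in> E" for k
  proof -
    from that obtain v where v: "v \<noteq> 0" "(transpose A ** A) *v v = k *s v" by (auto simp: E_def)
    then have "f v = k * (v \<bullet> v)" using M[of v v] by (simp add: f_def scalar_mult_eq_scaleR)
    then show ?thesis using f0[of v] v(1) by (simp add: zero_le_mult_iff power2_norm_eq_inner[symmetric])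
  qed
  have "w\<^sup>2 \<le> (sqrt (Inf E))\<^sup>2"
    using w by (intro power_mono) (simp_all add: sigma_min_def E_def)
  also have "\<dots> = Inf E"
    using lE E0 by (intro real_sqrt_pow2 cInf_greatest) auto
  also have "\<dots> \<le> l"
    using E0 by (intro cInf_lower lE bdd_belowI[of _ 0]) auto
  finally have "w\<^sup>2 * (v \<bullet> v) \<le> l * (v \<bullet> v)" by (intro mult_right_mono) auto
  then show ?thesis using ge[of v] by (simp add: f_def)
qed

text \<open>The lower bound makes the Gram map injective, hence surjective. For a preimage
  \<open>v\<close> of \<open>a\<close>, \<open>|A v|\<^sup>2\<close> equals
  \<open>a \<bullet> v\<close>, and Cauchy-Schwarz combined with \<open>lb\<close> bounds
  it.\<close>

lemma ex_preimage_transpose_norm_le: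
  fixes A :: "real ^ 'd ^ 'n"
  assumes c: "0 < c" and lb: "\<And>v. c * (v \<bullet> v) \<le> (A *v v) \<bullet> (A *v v)"
  obtains v where "transpose A *v (A *v v) = a" "(A *v v) \<bullet> (A *v v) \<le> (a \<bullet> a) / c"
proof -
  let ?M = "\<lambda>v. transpose A *v (A *v v)"
  have lin: "linear ?M"
    using linear_compose[of "(*v) A" "(*v) (transpose A)"] by (simp add: comp_def)
  have Mi: "?M v \<bullet> v = (A *v v) \<bullet> (A *v v)" for v
    by (simp add: dot_lmul_matrix)
  have "v = 0" if "?M v = 0" for v
  proof -
    have "c * (v \<bullet> v) \<le> 0" using lb[of v] Mi[of v] that by simp
    then show ?thesis using c by (simp add: mult_le_0_iff power2_norm_eq_inner[symmetric])
  qed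
  then have "inj ?M" unfolding linear_injective_0[OF lin] by blast
  then have "surj ?M" by (rule linear_injective_imp_surjective[OF lin]) simp
  then obtain v where v: "?M v = a" by (metis surjD)
  let ?b = "(A *v v) \<bullet> (A *v v)"
  have "?b = a \<bullet> v" using Mi[of v] v by simp
  then have "?b\<^sup>2 \<le> (a \<bullet> a) * (v \<bullet> v)"
    using Cauchy_Schwarz_ineq[of a v] by simp
  then have "c * ?b\<^sup>2 \<le> (a \<bullet> a) * (c * (v \<bullet> v))"
    using c by (simp add: mult.left_commute)
  also have "\<dots> \<le> (a \<bullet> a) * ?b"
    using lb[of v] by (intro mult_left_mono) auto
  finally have "?b * (c * ?b) \<le> ?b * (a \<bullet> a)"
    by (simp add: power2_eq_square algebra_simps)
  then have "c * ?b \<le> a \<bullet> a"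
    by (cases "?b = 0") (auto simp del: inner_eq_zero_iff simp: less_le mult_le_cancel_left)
  then have "?b \<le> (a \<bullet> a) / c"
    using c by (simp add: pos_le_divide_eq mult.commute)
  with v show ?thesis by (rule that)
qed

subsection \<open>Removing a row of the projected matrix\<close>

text \<open>In the plane spanned by the orthonormal vectors \<open>e\<close> and \<open>u\<close> this is the reflection with
  matrix rows \<open>(c, s)\<close> and \<open>(s, -c)\<close>; it fixes the orthogonal complement of the plane.\<close>
definition plane_reflection :: "'a::real_inner \<Rightarrow> 'a \<Rightarrow> real \<Rightarrow> real \<Rightarrow> 'a \<Rightarrow> 'a" where
  "plane_reflection e u c s x = x + ((c - 1) * (x \<bullet> e) + s * (x \<bullet> u)) *\<^sub>R e + (s * (x \<bullet> e) - (c + 1) * (x \<bullet> u)) *\<^sub>R u"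

lemma plane_reflection_inner:
  assumes "e \<bullet> e = 1" "u \<bullet> u = 1" "u \<bullet> e = 0"
  shows "plane_reflection e u c s x \<bullet> e = c * (x \<bullet> e) + s * (x \<bullet> u)"
    and "plane_reflection e u c s x \<bullet> u = s * (x \<bullet> e) - c * (x \<bullet> u)"
  using assms by (simp_all add: plane_reflection_def inner_add_left inner_commute[of e u] algebra_simps)

lemma orthogonal_transformation_plane_reflection:
  assumes "e \<bullet> e = 1" "u \<bullet> u = 1" "u \<bullet> e = 0" and cs: "c\<^sup>2 + s\<^sup>2 = 1"
  shows "orthogonal_transformation (plane_reflection e u c s)"
  unfolding orthogonal_transformation_def
proof (intro conjI allI)
  show "linear (plane_reflection e u c s)"
    by (rule linearI) (simp_all add: plane_reflection_def inner_add_left algebra_simps scaleR_add_right)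
  fix x y
  let ?P = "plane_reflection e u c s"
  have "?P x \<bullet> ?P y = ?P x \<bullet> y + ((c - 1) * (y \<bullet> e) + s * (y \<bullet> u)) * (?P x \<bullet> e) + (s * (y \<bullet> e) - (c + 1) * (y \<bullet> u)) * (?P x \<bullet> u)"
    by (subst (2) plane_reflection_def) (simp add: inner_add_right)
  also have "?P x \<bullet> y = x \<bullet> y + ((c - 1) * (x \<bullet> e) + s * (x \<bullet> u)) * (y \<bullet> e) + (s * (x \<bullet> e) - (c + 1) * (x \<bullet> u)) * (y \<bullet> u)"
    by (simp add: plane_reflection_def inner_add_left inner_commute[of e y] inner_commute[of u y])
  finally have "?P x \<bullet> ?P y = x \<bullet> y + (c\<^sup>2 + s\<^sup>2 - 1) * ((x \<bullet> e) * (y \<bullet> e) + (x \<bullet> u) * (y \<bullet> u))"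
    unfolding plane_reflection_inner[OF assms(1-3)] by (simp add: algebra_simps power2_eq_square)
  then show "?P x \<bullet> ?P y = x \<bullet> y" by (simp add: cs)
qed

text \<open>The update is \<open>F0\<close> applied to \<open>x + (x $ i) b\<close>. As
  \<open>F0\<close> kills the axis \<open>e\<close>, in the plane of \<open>e\<close> and
  \<open>u\<close> only the \<open>u\<close>-coordinate
  \<open>x \<bullet> u + \<beta> * (x \<bullet> e)\<close> counts, a functional of norm
  \<open>k\<close>. \<open>H\<close> turns its direction into \<open>e\<close>, the scaling supplies
  \<open>k\<close>, and \<open>V\<close> swaps \<open>e\<close> with \<open>u\<close>.\<close>

lemma rank_one_update_factorization:
  fixes F0 :: "real ^ 'n \<Rightarrow> 'b::real_vector"
  assumes lin: "linear F0" and i: "F0 (axis i 1) = 0" and b: "F0 b = a" "b $ i = 0" "b \<noteq> 0"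
  obtains V H where "orthogonal_transformation V" "orthogonal_transformation H"
    "\<And>x. F0 x + (x $ i) *\<^sub>R a = F0 (V (\<chi> l. (if l = i then sqrt (1 + b \<bullet> b) else 1) * H x $ l))"
proof -
  define e :: "real ^ 'n" where "e = axis i 1"
  define \<beta> where "\<beta> = norm b"
  define k where "k = sqrt (1 + b \<bullet> b)"
  define u where "u = (1 / \<beta>) *\<^sub>R b"
  define V where "V = plane_reflection e u 0 1"
  \<comment> \<open>These coefficients send the unit vector \<open>(\<beta> e + u) / k\<close> to
    \<open>e\<close>.\<close>
  define H where "H = plane_reflection e u (\<beta> / k) (1 / k)"
  have \<beta>: "0 < \<beta>" using b by (simp add: \<beta>_def)
  have k: "k\<^sup>2 = 1 + \<beta>\<^sup>2" "0 < k"
    by (auto simp: k_def \<beta>_def power2_norm_eq_inner add_pos_nonneg)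
  have xe: "x \<bullet> e = x $ i" for x by (simp add: e_def inner_axis)
  have on: "e \<bullet> e = 1" "u \<bullet> u = 1" "u \<bullet> e = 0"
    using \<beta> b by (auto simp: u_def xe \<beta>_def power2_norm_eq_inner[symmetric] power2_eq_square)
      (auto simp: e_def)
  have F0u: "\<beta> *\<^sub>R F0 u = a"
    using \<beta> b by (simp add: u_def linear_scale[OF lin])
  have F0e: "F0 e = 0" using i by (simp add: e_def)
  note lins = linear_add[OF lin] linear_scale[OF lin]
  show ?thesis
  proof
    show "orthogonal_transformation V"
      unfolding V_def by (rule orthogonal_transformation_plane_reflection[OF on]) simp
    show "orthogonal_transformation H"
      unfolding H_def
    proof (rule orthogonal_transformation_plane_reflection[OF on])
      have "(\<beta> / k)\<^sup>2 + (1 / k)\<^sup>2 = (1 + \<beta>\<^sup>2) / k\<^sup>2"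
        by (simp add: power_divide add_divide_distrib)
      then show "(\<beta> / k)\<^sup>2 + (1 / k)\<^sup>2 = 1" using k(2) by (simp only: k(1)[symmetric]) simp
    qed
    fix x
    define D where "D = (\<chi> l. (if l = i then k else 1) * H x $ l)"
    have D: "D = H x + ((k - 1) * (H x \<bullet> e)) *\<^sub>R e"
      by (auto simp: D_def vec_eq_iff xe algebra_simps) (auto simp: e_def axis_def algebra_simps)
    have He: "k * (H x \<bullet> e) = \<beta> * (x \<bullet> e) + x \<bullet> u"
      unfolding H_def plane_reflection_inner[OF on] using k by (simp add: field_simps)
    have Hu: "H x \<bullet> u = (1 / k) * (x \<bullet> e) - (\<beta> / k) * (x \<bullet> u)"
      unfolding H_def plane_reflection_inner[OF on] by simp
    have De: "D \<bullet> e = k * (H x \<bullet> e)" and Du: "D \<bullet> u = H x \<bullet> u"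
      unfolding D by (simp_all add: inner_add_left on inner_commute[of e u] algebra_simps)
    have "F0 (V D) = F0 D + (D \<bullet> e - D \<bullet> u) *\<^sub>R F0 u"
      by (simp add: V_def plane_reflection_def lins F0e)
    also have "F0 D = F0 (H x)" unfolding D by (simp add: lins F0e)
    also have "F0 (H x) = F0 x + ((1 / k) * (x \<bullet> e) - (\<beta> / k + 1) * (x \<bullet> u)) *\<^sub>R F0 u"
      unfolding H_def plane_reflection_def by (simp add: lins F0e)
    finally have "F0 (V D) = F0 x + (((1 / k) * (x \<bullet> e) - (\<beta> / k + 1) * (x \<bullet> u)) + (D \<bullet> e - D \<bullet> u)) *\<^sub>R F0 u"
      by (simp add: scaleR_add_left)
    also have "((1 / k) * (x \<bullet> e) - (\<beta> / k + 1) * (x \<bullet> u)) + (D \<bullet> e - D \<bullet> u) = (x $ i) * \<beta>"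
      unfolding De Du He Hu by (simp add: algebra_simps xe)
    also have "F0 x + (x $ i * \<beta>) *\<^sub>R F0 u = F0 x + (x $ i) *\<^sub>R a"
      using F0u by (simp add: scaleR_scaleR[symmetric] del: scaleR_scaleR)
    finally show "F0 x + (x $ i) *\<^sub>R a = F0 (V (\<chi> l. (if l = i then sqrt (1 + b \<bullet> b) else 1) * H x $ l))"
      unfolding D_def k_def by simp
  qed
qed

section \<open>Matrices flattened to vectors indexed by pairs, and maps acting row by row\<close>

definition row_of :: "real ^ ('r::finite \<times> 'n::finite) \<Rightarrow> 'r \<Rightarrow> real ^ 'n" where
  "row_of y i = (\<chi> l. y $ (i, l))"

definition map_rows :: "(real ^ 'n \<Rightarrow> real ^ 'n) \<Rightarrow> real ^ ('r::finite \<times> 'n::finite) \<Rightarrow> real ^ ('r \<times> 'n)" where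
  "map_rows f y = (\<chi> p. f (row_of y (fst p)) $ snd p)"

lemma row_of_map_rows [simp]: "row_of (map_rows f y) i = f (row_of y i)"
  by (simp add: row_of_def map_rows_def)

lemma inner_rows: "x \<bullet> y = (\<Sum>i\<in>UNIV. row_of x i \<bullet> row_of y i)"
  by (simp add: inner_vec_def row_of_def sum.cartesian_product UNIV_Times_UNIV)

lemma orthogonal_transformation_map_rows:
  assumes f: "orthogonal_transformation f"
  shows "orthogonal_transformation (map_rows f)"
  unfolding orthogonal_transformation_def
proof (intro conjI allI)
  have lin: "linear f" by (rule orthogonal_transformation_linear[OF f])
  have rows: "row_of (x + y) i = row_of x i + row_of y i" "row_of (c *\<^sub>R x) i = c *\<^sub>R row_of x i" for x y i c
    by (auto simp: row_of_def vec_eq_iff)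
  show "linear (map_rows f)"
    by (rule linearI) (simp_all add: map_rows_def vec_eq_iff rows linear_add[OF lin] linear_scale[OF lin])
  show "map_rows f v \<bullet> map_rows f w = v \<bullet> w" for v w
    using f by (simp add: inner_rows orthogonal_transformation_def)
qed

text \<open>The product \<open>R ** A\<close> for flattened \<open>R\<close>: its rows are the
  images under \<open>transpose A\<close> of the rows of \<open>R\<close>.\<close>

definition mult_rows :: "real ^ 'd ^ 'n \<Rightarrow> real ^ ('r::finite \<times> 'n::finite) \<Rightarrow> real ^ 'd ^ 'r" where
  "mult_rows A y = (\<chi> i. transpose A *v row_of y i)"

lemma measurable_mult_rows [measurable]: "mult_rows A \<in> borel_measurable borel"
proof (intro borel_measurable_linear linearI)
  show "mult_rows A (x + y) = mult_rows A x + mult_rows A y" for x y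
    by (simp add: mult_rows_def row_of_def vec_eq_iff matrix_vector_mult_def sum.distrib algebra_simps)
  show "mult_rows A (c *\<^sub>R x) = c *\<^sub>R mult_rows A x" for c x
    by (simp add: mult_rows_def row_of_def vec_eq_iff matrix_vector_mult_def sum_distrib_left algebra_simps)
qed

lemma gaussian_projection_eq:
  fixes A :: "real ^ 'd ^ 'n"
  shows "(gaussian_projection A :: (real ^ 'd ^ 'r) measure) = distr (normal_vec (\<lambda>_. 1)) borel (mult_rows A)"
proof -
  let ?P = "PiM (UNIV :: ('r \<times> 'n) set) (\<lambda>_. density lborel std_normal_density)"
  have [measurable]: "(\<lambda>f. f p) \<in> borel_measurable ?P" for p
    using measurable_component_singleton[of p UNIV "\<lambda>_. density lborel std_normal_density"] by simp
  have [measurable]: "(\<lambda>f. \<chi> i j. f (i, j)) \<in> borel_measurable ?P"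
    by (subst borel_measurable_euclidean_space) (auto simp: Basis_vec_def inner_axis)
  have [measurable]: "(\<lambda>f. \<chi> p. f p) \<in> borel_measurable ?P"
    by (subst borel_measurable_euclidean_space) (auto simp: Basis_vec_def inner_axis)
  have "linear (\<lambda>R :: real ^ 'n ^ 'r. R ** A)"
    by (intro linearI) (simp_all add: matrix_matrix_mult_def vec_eq_iff sum.distrib sum_distrib_left algebra_simps)
  then have [measurable]: "(\<lambda>R :: real ^ 'n ^ 'r. R ** A) \<in> borel_measurable borel"
    by (rule borel_measurable_linear)
  have "(gaussian_projection A :: (real ^ 'd ^ 'r) measure) = distr ?P borel (\<lambda>f. (\<chi> i j. f (i, j)) ** A)"
    by (simp add: gaussian_projection_def gaussian_matrix_def distr_distr comp_def)
  also have "(\<lambda>f. (\<chi> i j. f (i, j)) ** A) = (\<lambda>f. mult_rows A (\<chi> p. f p))"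
    by (simp add: fun_eq_iff vec_eq_iff mult_rows_def row_of_def matrix_matrix_mult_def
        matrix_vector_mult_def transpose_def mult.commute)
  also have "distr ?P borel (\<lambda>f. mult_rows A (\<chi> p. f p)) = distr (distr ?P borel (\<lambda>f. \<chi> p. f p)) borel (mult_rows A)"
    by (simp add: distr_distr comp_def)
  also have "distr ?P borel (\<lambda>f. \<chi> p. f p) = normal_vec (\<lambda>_. 1)"
    by (subst normal_vec_eq_distr_PiM) auto
  finally show ?thesis .
qed

text \<open>Zeroing rather than deleting the row keeps the index type, so the same \<open>R\<close>
  multiplies both matrices.\<close>

definition zero_row :: "'n \<Rightarrow> real ^ 'd ^ 'n \<Rightarrow> real ^ 'd ^ 'n" where
  "zero_row i A = (\<chi> k. if k = i then 0 else A $ k)"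

lemma transpose_zero_row: "transpose A *v x = transpose (zero_row i A) *v x + (x $ i) *\<^sub>R (A $ i)"
  for A :: "real ^ 'd ^ 'n"
proof -
  have "(\<Sum>k\<in>UNIV. A $ k $ j * x $ k) = (\<Sum>k\<in>UNIV. zero_row i A $ k $ j * x $ k) + x $ i * A $ i $ j" for j
    by (simp add: zero_row_def if_distrib[of "\<lambda>z. z $ j"] if_distrib[of "\<lambda>z. z * _"] sum.remove[of UNIV i] cong: if_cong)
  then show ?thesis
    by (simp add: vec_eq_iff matrix_vector_mult_def transpose_def)
qed

lemma zero_row_mult_i [simp]: "(zero_row i A *v v) $ i = 0" for A :: "real ^ 'd ^ 'n"
  by (simp add: zero_row_def matrix_vector_mult_def)

lemma transpose_zero_row_axis: "transpose (zero_row i A) *v axis i 1 = 0" for A :: "real ^ 'd ^ 'n"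
  using inner_transpose_mult[of "zero_row i A" "axis i 1"]
  by (metis inner_axis_axis inner_eq_zero_iff inner_commute inner_axis mult.left_neutral zero_row_mult_i real_inner_1_left)

text \<open>Quantifies what erasing a row costs in the quadratic form; this carries the singular
  value bound over to \<open>zero_row i A\<close>.\<close>

lemma inner_zero_row_mult:
  fixes A :: "real ^ 'd ^ 'n"
  shows "(A *v v) \<bullet> (A *v v) = (zero_row i A *v v) \<bullet> (zero_row i A *v v) + (A $ i \<bullet> v)\<^sup>2"
proof -
  have "(A *v v) $ k = A $ k \<bullet> v" for k
    by (simp add: matrix_vector_mult_def inner_vec_def)
  moreover have "(zero_row i A *v v) $ k = (if k = i then 0 else A $ k \<bullet> v)" for k
    by (simp add: matrix_vector_mult_def inner_vec_def zero_row_def)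
  ultimately show ?thesis
    by (simp add: inner_vec_def[of "A *v v"] inner_vec_def[of "zero_row i A *v v"] sum.remove[of UNIV i] power2_eq_square)
qed

text \<open>The factorization is applied to every row of \<open>R\<close>. Rotation invariance
  absorbs \<open>H\<close>, the scaling acts on column \<open>i\<close>, which is \<open>J\<close>,
  and \<open>V\<close> joins \<open>\<Psi>\<close>. For \<open>zero_row i A\<close> nothing is
  scaled, so \<open>V\<close> is absorbed as well.\<close>

lemma gaussian_projection_zero_row_laws:
  fixes A :: "real ^ 'd ^ 'n" and b :: "real ^ 'n" and i :: 'n
  defines "J \<equiv> {p :: 'r::finite \<times> 'n. snd p = i}"
  assumes b: "transpose (zero_row i A) *v b = A $ i" "b $ i = 0" "b \<noteq> 0"
  obtains \<Psi> :: "real ^ ('r \<times> 'n) \<Rightarrow> real ^ 'd ^ 'r" where "\<Psi> \<in> borel_measurable borel"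
    "gaussian_projection A = distr (normal_vec (block_scale J (1 + b \<bullet> b))) borel \<Psi>"
    "gaussian_projection (zero_row i A) = distr (normal_vec (block_scale J 1)) borel \<Psi>"
proof -
  obtain V H where V: "orthogonal_transformation V" and H: "orthogonal_transformation H" and
    fac: "\<And>x. transpose (zero_row i A) *v x + (x $ i) *\<^sub>R (A $ i) =
      transpose (zero_row i A) *v (V (\<chi> l. (if l = i then sqrt (1 + b \<bullet> b) else 1) * H x $ l))"
    using rank_one_update_factorization[OF matrix_vector_mul_linear transpose_zero_row_axis b] by blast
  let ?N = "normal_vec (\<lambda>_. 1) :: (real ^ ('r \<times> 'n)) measure"
  let ?V = "map_rows V :: real ^ ('r \<times> 'n) \<Rightarrow> _" and ?H = "map_rows H :: real ^ ('r \<times> 'n) \<Rightarrow> _"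
  let ?D = "\<lambda>y :: real ^ ('r \<times> 'n). \<chi> p. block_scale J (1 + b \<bullet> b) p * y $ p"
  have V': "orthogonal_transformation ?V" and H': "orthogonal_transformation ?H"
    using V H by (simp_all add: orthogonal_transformation_map_rows)
  have [measurable]: "?V \<in> borel_measurable borel" "?H \<in> borel_measurable borel"
    using V' H' by (simp_all add: orthogonal_transformation_linear borel_measurable_linear)
  have [measurable]: "?D \<in> borel_measurable borel"
    by (intro borel_measurable_continuous_onI continuous_intros)
  define \<Psi> where "\<Psi> y = mult_rows (zero_row i A) (?V y)" for y
  have [measurable]: "\<Psi> \<in> borel_measurable borel"
    unfolding \<Psi>_def by measurable
  have bs1: "block_scale J 1 = (\<lambda>_. 1)" by (simp add: fun_eq_iff block_scale_def)
  have pos: "0 < block_scale J (1 + b \<bullet> b) p" for p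
    by (simp add: block_scale_pos add_pos_nonneg)
  have row_D: "row_of (?D y) k = (\<chi> l. (if l = i then sqrt (1 + b \<bullet> b) else 1) * row_of y k $ l)" for y k
    by (simp add: row_of_def block_scale_def J_def vec_eq_iff)
  have "mult_rows A y = \<Psi> (?D (?H y))" for y
    unfolding \<Psi>_def mult_rows_def
    by (simp only: vec_eq_iff vec_lambda_beta row_of_map_rows row_D transpose_zero_row[of A _ i] fac) simp
  then have "mult_rows A = (\<lambda>y. \<Psi> (?D (?H y)))" by (rule ext)
  then have "gaussian_projection A = distr ?N borel (\<lambda>y. \<Psi> (?D (?H y)))"
    by (simp only: gaussian_projection_eq)
  also have "\<dots> = distr (distr (distr ?N borel ?H) borel ?D) borel \<Psi>"
    by (simp add: distr_distr comp_def)
  also have "\<dots> = distr (normal_vec (block_scale J (1 + b \<bullet> b))) borel \<Psi>"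
    by (simp add: distr_normal_vec_orthogonal[OF H'] distr_normal_vec_scale[OF pos])
  finally have 1: "gaussian_projection A = distr (normal_vec (block_scale J (1 + b \<bullet> b))) borel \<Psi>" .
  have "distr (normal_vec (block_scale J 1)) borel \<Psi> = distr (distr ?N borel ?V) borel (mult_rows (zero_row i A))"
    by (simp add: bs1 distr_distr comp_def \<Psi>_def[abs_def])
  then have 2: "gaussian_projection (zero_row i A) = distr (normal_vec (block_scale J 1)) borel \<Psi>"
    by (simp add: gaussian_projection_eq distr_normal_vec_orthogonal[OF V'])
  show ?thesis by (rule that[OF _ 1 2]) simp
qed

text \<open>Both laws are images under one map \<open>\<Psi>\<close>, so the comparisons of block
  Gaussians transfer through preimages of \<open>S\<close>. The vector \<open>b\<close> lies in the
  range of \<open>zero_row i A\<close>, hence \<open>b $ i = 0\<close>.\<close>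

lemma gaussian_projection_zero_row_approx:
  fixes A :: "real ^ 'd ^ 'n"
  assumes c: "0 < c" and lb: "\<And>v. c * (v \<bullet> v) \<le> (zero_row i A *v v) \<bullet> (zero_row i A *v v)"
    and \<eta>: "(A $ i) \<bullet> (A $ i) \<le> c * \<eta>" and t: "0 < t" and S: "S \<in> sets borel"
  shows "measure (gaussian_projection A :: (real ^ 'd ^ 'r) measure) S
      \<le> exp (\<eta> * (real CARD('r) * \<eta> / 4 + sqrt (real CARD('r) * t) + t)) * measure (gaussian_projection (zero_row i A) :: (real ^ 'd ^ 'r) measure) S + exp (- t)"
      (is "?le1")
    and "measure (gaussian_projection (zero_row i A) :: (real ^ 'd ^ 'r) measure) S
      \<le> exp (\<eta> * (real CARD('r) * \<eta> / 4 + sqrt (real CARD('r) * t))) * measure (gaussian_projection A :: (real ^ 'd ^ 'r) measure) S + exp (- t)"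
      (is "?le2")
proof -
  obtain v where v: "transpose (zero_row i A) *v (zero_row i A *v v) = A $ i"
    and vn: "(zero_row i A *v v) \<bullet> (zero_row i A *v v) \<le> (A $ i \<bullet> A $ i) / c"
    using ex_preimage_transpose_norm_le[OF c lb] by blast
  define b where "b = zero_row i A *v v"
  have b\<eta>: "b \<bullet> b \<le> \<eta>"
    using vn \<eta> c unfolding b_def by (smt (verit) pos_divide_le_eq mult.commute)
  have \<eta>0: "0 \<le> \<eta>" using b\<eta> by (smt (verit) inner_ge_zero)
  have "?le1 \<and> ?le2"
  proof (cases "b = 0")
    \<comment> \<open>The factorization requires \<open>b \<noteq> 0\<close>; here row
      \<open>i\<close> is zero already and both projections coincide.\<close>
    case True
    then have "A $ i = 0" using v by (simp add: b_def)
    then have "zero_row i A = A" by (simp add: zero_row_def vec_eq_iff)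
    moreover have "q \<le> exp z * q + exp (- t)" if "0 \<le> z" "0 \<le> q" for z q :: real
      using that by (smt (verit) exp_ge_zero mult_right_mono mult_cancel_right1 one_le_exp_iff)
    ultimately show ?thesis
      using \<eta>0 t by auto
  next
    case False
    define J where "J = {p :: 'r \<times> 'n. snd p = i}"
    have "J = UNIV \<times> {i}" by (auto simp: J_def)
    then have J: "card J = CARD('r)" "J \<noteq> {}" by (simp_all add: card_cartesian_product)
    obtain \<Psi> :: "real ^ ('r \<times> 'n) \<Rightarrow> real ^ 'd ^ 'r" where [measurable]: "\<Psi> \<in> borel_measurable borel" and
      \<Psi>: "gaussian_projection A = distr (normal_vec (block_scale J (1 + b \<bullet> b))) borel \<Psi>"
        "gaussian_projection (zero_row i A) = distr (normal_vec (block_scale J 1)) borel \<Psi>"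
      using gaussian_projection_zero_row_laws[of i A b] v False unfolding J_def b_def by auto
    have S': "\<Psi> -` S \<in> sets borel"
      using measurable_sets[of \<Psi> borel borel S] S by simp
    have "measure (distr (normal_vec \<sigma>) borel \<Psi>) S = measure (normal_vec \<sigma>) (\<Psi> -` S)" for \<sigma> :: "'r \<times> 'n \<Rightarrow> real"
      using S by (subst measure_distr) auto
    then show ?thesis
      unfolding \<Psi>
      using normal_vec_inflated_approx_dominated[OF J(2) inner_ge_zero b\<eta> t refl S']
        normal_vec_deflated_approx_dominated[OF J(2) inner_ge_zero b\<eta> t refl S']
      by (simp add: J(1))
  qed
  then show ?le1 ?le2 by auto
qed

section \<open>The privacy budget and the composition of the two comparisons\<close>

text \<open>The two losses are at the error levels \<open>exp (- T)\<close> and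
  \<open>exp (- (T + \<epsilon>))\<close>. The factor \<open>1 + \<epsilon> / T\<close> in the
  calibration pays for the larger exponent of the second and for the terms quadratic in
  \<open>\<eta>\<close>.\<close>

lemma privacy_budget:
  fixes \<epsilon> T r \<eta> :: real
  assumes \<epsilon>: "0 < \<epsilon>" and T: "0 < T" and r: "0 < r" and \<eta>: "0 < \<eta>"
    and eq: "\<eta> * ((1 + \<epsilon> / T) * (2 * sqrt (2 * r * T) + 2 * T)) = \<epsilon>"
  shows "\<eta> * (r * \<eta> / 4 + sqrt (r * T) + T) + \<eta> * (r * \<eta> / 4 + sqrt (r * (T + \<epsilon>))) \<le> \<epsilon>"
proof -
  define g where "g = sqrt (r * T)"
  define s where "s = \<epsilon> / T"
  let ?K = "(1 + s) * (2 * sqrt (2 * r * T) + 2 * T)"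
  have g: "0 < g" "g\<^sup>2 = r * T" using r T by (simp_all add: g_def)
  have s: "0 < s" using \<epsilon> T by (simp add: s_def)
  have "g \<le> sqrt (2 * r * T)" unfolding g_def using r T by simp
  then have "(1 + s) * (2 * g + 2 * T) \<le> ?K"
    using s by (intro mult_left_mono) auto
  moreover have "(1 + s) * (2 * g + 2 * T) = 2 * g + 2 * T + 2 * (s * g) + 2 * (s * T)"
    by (simp add: algebra_simps)
  ultimately have K: "2 * g + 2 * T + 2 * (s * g) \<le> ?K"
    using mult_pos_pos[OF s T] by linarith
  \<comment> \<open>This is \<open>sqrt (1 + s) \<le> 1 + s / 2\<close>, multiplied by
    \<open>g\<close>.\<close>
  have Q: "sqrt (r * (T + \<epsilon>)) \<le> g + s * g / 2"
  proof (rule real_le_lsqrt)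
    have "(g + s * g / 2)\<^sup>2 = g\<^sup>2 * (1 + s + s\<^sup>2 / 4)"
      by (simp add: power2_eq_square algebra_simps)
    also have "\<dots> \<ge> g\<^sup>2 * (1 + s)"
      by (intro mult_left_mono) auto
    also have "g\<^sup>2 * (1 + s) = r * (T + \<epsilon>)"
      using T by (simp add: g s_def field_simps)
    finally show "r * (T + \<epsilon>) \<le> (g + s * g / 2)\<^sup>2" .
  qed (use g s in auto)
  \<comment> \<open>The calibration itself bounds the quadratic terms:
    \<open>2 * \<eta> * g \<le> \<epsilon>\<close> times \<open>g\<close> gives
    \<open>2 * r * \<eta> \<le> s * g\<close>.\<close>
  have "2 * g \<le> ?K"
    using K T mult_pos_pos[OF s g(1)] by linarith
  then have "\<eta> * (2 * g) \<le> \<eta> * ?K"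
    using \<eta> by (intro mult_left_mono) auto
  then have "\<eta> * (2 * g) \<le> \<epsilon>" using eq by (simp add: s_def)
  then have "(\<eta> * (2 * g)) * g \<le> \<epsilon> * g" using g by (intro mult_right_mono) auto
  then have "2 * \<eta> * (r * T) \<le> \<epsilon> * g"
    by (simp add: g(2)[symmetric] power2_eq_square mult.assoc mult.left_commute)
  then have R: "2 * (r * \<eta>) \<le> s * g"
    using T by (simp add: s_def field_simps)
  have "(r * \<eta> / 4 + g + T) + (r * \<eta> / 4 + sqrt (r * (T + \<epsilon>))) \<le> ?K"
    using K Q R T mult_pos_pos[OF s g(1)] by linarith
  then have "\<eta> * ((r * \<eta> / 4 + g + T) + (r * \<eta> / 4 + sqrt (r * (T + \<epsilon>)))) \<le> \<eta> * ?K"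
    using \<eta> by (intro mult_left_mono) auto
  then show ?thesis
    using eq by (simp add: s_def g_def distrib_left)
qed

theorem theoremB1:
  fixes \<epsilon> \<delta> B w :: real
  assumes eps: "\<epsilon> > 0"
    and delta: "0 < \<delta>" "\<delta> < 1 / exp 1"
    and B: "B > 0"
    and d_lt_r: "CARD('d) < CARD('r)"
    and w_nonneg: "w \<ge> 0"
    and w_def: "w\<^sup>2 = B\<^sup>2 * (1 + (1 + \<epsilon> / ln (4 / \<delta>)) / \<epsilon> *
                   (2 * sqrt (2 * real CARD('r) * ln (4 / \<delta>)) + 2 * ln (4 / \<delta>)))"
  shows "diff_private
           (gaussian_projection :: real ^ 'd ^ 'n \<Rightarrow> (real ^ 'd ^ 'r) measure)
           (\<lambda>A. (\<forall>i. norm (A $ i) \<le> B) \<and> sigma_min A \<ge> w)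
           neighbors \<epsilon> \<delta>"
  unfolding diff_private_def
proof (intro allI impI ballI, elim conjE)
  fix A A' :: "real ^ 'd ^ 'n" and S :: "(real ^ 'd ^ 'r) set"
  assume rows: "\<forall>i. norm (A $ i) \<le> B" "\<forall>i. norm (A' $ i) \<le> B"
    and \<sigma>: "w \<le> sigma_min A" and nb: "neighbors A A'"
    and "S \<in> sets (gaussian_projection A)"
  then have S: "S \<in> sets borel" by (simp add: gaussian_projection_def)
  define T where "T = ln (4 / \<delta>)"
  define r where "r = real CARD('r)"
  define K where "K = (1 + \<epsilon> / T) * (2 * sqrt (2 * r * T) + 2 * T)"
  \<comment> \<open>By \<open>w_def\<close> this is
    \<open>B\<^sup>2 / (w\<^sup>2 - B\<^sup>2)\<close>, the bound for
    \<open>|b|\<^sup>2\<close>.\<close>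
  define \<eta> where "\<eta> = \<epsilon> / K"
  define c where "c = w\<^sup>2 - B\<^sup>2"
  have "\<delta> < 1"
    using delta(2) less_trans[of \<delta> "1 / exp 1" 1] by simp
  then have T: "0 < T" using delta(1) by (simp add: T_def)
  have expT: "exp (- T) = \<delta> / 4" using delta(1) by (simp add: T_def exp_minus)
  have r: "0 < r" by (simp add: r_def)
  have K: "0 < K"
    unfolding K_def using eps T r by (intro mult_pos_pos add_pos_pos) auto
  have \<eta>: "0 < \<eta>" and \<eta>K: "\<eta> * K = \<epsilon>" using eps K by (simp_all add: \<eta>_def)
  have "w\<^sup>2 = B\<^sup>2 * (1 + K / \<epsilon>)"
    unfolding w_def K_def T_def r_def times_divide_eq_left ..
  then have c_eq: "c = B\<^sup>2 * (K / \<epsilon>)"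
    by (simp add: c_def distrib_left)
  have c: "0 < c" unfolding c_eq using B K eps by simp
  have c\<eta>: "c * \<eta> = B\<^sup>2" unfolding c_eq \<eta>_def using K eps by simp
  obtain i where i: "{i. A $ i \<noteq> A' $ i} = {i}"
    using nb unfolding neighbors_def by (auto simp: card_1_singleton_iff)
  define A0 where "A0 = zero_row i A"
  have "A' $ k = A $ k" if "k \<noteq> i" for k
  proof -
    have "k \<notin> {i. A $ i \<noteq> A' $ i}" unfolding i using that by simp
    then show ?thesis by simp
  qed
  \<comment> \<open>Both neighbors pass through the same intermediate matrix, so \<open>lb\<close>
    serves both comparisons.\<close>
  then have A0': "zero_row i A' = A0"
    by (simp add: A0_def zero_row_def cong: if_cong)
  have row_sq: "M $ i \<bullet> M $ i \<le> B\<^sup>2" if "\<forall>i. norm (M $ i) \<le> B" for M :: "real ^ 'd ^ 'n"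
    using that by (simp add: power2_norm_eq_inner[symmetric] power_mono)
  have lb: "c * (v \<bullet> v) \<le> (A0 *v v) \<bullet> (A0 *v v)" for v
  proof -
    have "w\<^sup>2 * (v \<bullet> v) \<le> (A0 *v v) \<bullet> (A0 *v v) + (A $ i \<bullet> v)\<^sup>2"
      using sigma_min_lower_bound[OF w_nonneg \<sigma>, of v] by (simp add: inner_zero_row_mult[of A v i] A0_def)
    moreover have "(A $ i \<bullet> v)\<^sup>2 \<le> B\<^sup>2 * (v \<bullet> v)"
      using Cauchy_Schwarz_ineq[of "A $ i" v] row_sq[OF rows(1)] by (smt (verit) inner_ge_zero mult_right_mono)
    ultimately show ?thesis by (simp add: c_def left_diff_distrib)
  qed
  define \<epsilon>1 where "\<epsilon>1 = \<eta> * (r * \<eta> / 4 + sqrt (r * T) + T)"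
  define \<epsilon>2 where "\<epsilon>2 = \<eta> * (r * \<eta> / 4 + sqrt (r * (T + \<epsilon>)))"
  have sum: "\<epsilon>1 + \<epsilon>2 \<le> \<epsilon>"
    unfolding \<epsilon>1_def \<epsilon>2_def using \<eta>K
    by (intro privacy_budget eps T r \<eta>) (simp add: K_def)
  have "0 \<le> \<epsilon>2" unfolding \<epsilon>2_def using \<eta> r T eps by simp
  define P where "P M = measure (gaussian_projection M :: (real ^ 'd ^ 'r) measure) S" for M :: "real ^ 'd ^ 'n"
  have P0: "0 \<le> P M" for M by (simp add: P_def)
  have "P A \<le> exp \<epsilon>1 * P A0 + exp (- T)"
    using gaussian_projection_zero_row_approx(1)[OF c lb[unfolded A0_def] _ T S, where \<eta> = \<eta>] row_sq[OF rows(1)] c\<eta>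
    by (simp add: P_def A0_def \<epsilon>1_def r_def)
  also have "P A0 \<le> exp \<epsilon>2 * P A' + exp (- (T + \<epsilon>))"
    using gaussian_projection_zero_row_approx(2)[OF c lb[folded A0'] _ _ S, where \<eta> = \<eta> and t = "T + \<epsilon>"]
      row_sq[OF rows(2)] c\<eta> T eps
    by (simp add: P_def A0' \<epsilon>2_def r_def)
  finally have "P A \<le> exp \<epsilon>1 * (exp \<epsilon>2 * P A' + exp (- (T + \<epsilon>))) + exp (- T)"
    by simp
  also have "\<dots> = exp (\<epsilon>1 + \<epsilon>2) * P A' + exp (\<epsilon>1 + - (T + \<epsilon>)) + exp (- T)"
    by (simp only: exp_add[of \<epsilon>1] distrib_left mult.assoc)
  \<comment> \<open>From \<open>sum\<close> and \<open>0 \<le> \<epsilon>2\<close> follows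
    \<open>\<epsilon>1 \<le> \<epsilon>\<close>, so the amplified error
    \<open>exp (\<epsilon>1 - (T + \<epsilon>))\<close> is at most \<open>exp (- T)\<close>.\<close>
  also have "\<dots> \<le> exp \<epsilon> * P A' + exp (- T) + exp (- T)"
    using sum \<open>0 \<le> \<epsilon>2\<close> P0 by (intro add_mono mult_right_mono) auto
  \<comment> \<open>Each \<open>exp (- T)\<close> is \<open>\<delta> / 4\<close>, so the errors add
    up to \<open>\<delta> / 2\<close>.\<close>
  also have "\<dots> \<le> exp \<epsilon> * P A' + \<delta>"
    using delta(1) by (simp add: expT)
  finally show "measure (gaussian_projection A) S \<le> exp \<epsilon> * measure (gaussian_projection A') S + \<delta>"
    by (simp add: P_def)
qed

end
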